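(* Let a data set $\{(x_i,y_i): i\in\mathbb{N}_N\}$ (with derivative values $d_i$ at $x_i$) be given, let $c<\min\{y_i:i\in\mathbb{N}_N\}$ and $d>\max\{y_i:i\in\mathbb{N}_N\}$, and let $\Psi$ be the corresponding $\mathcal{C}^1$-rational cubic spline fractal interpolation function with scaling factors $\alpha_i$ and shape parameters $u_i,v_i$. Then the following conditions on the scaling factors and shape parameters, for each $i\in\mathbb{N}_{N-1}$, are sufficient for the graph of $\Psi$ to be contained in the rectangle $K=[x_1,x_N]\times[c,d]$: $$\alpha_i^{\min}<\alpha_i<\alpha_i^{\max},\qquad u_i>0,\qquad v_i>\max\{0,v_{1i},v_{2i},v_{3i},v_{4i},v_{5i},v_{6i},v_{7i},v_{8i}\},$$ where $\alpha_i^{\min},\alpha_i^{\max}$ are real numbers with $$\alpha_i^{\max}<\min\Big\{a_i,\frac{y_i-c}{y_1-c},\frac{y_{i+1}-c}{y_N-c},\frac{d-y_i}{d-y_1},\frac{d-y_{i+1}}{d-y_N}\Big\},$$ $$\alpha_i^{\min}>\max\Big\{-a_i,\frac{y_i-c}{y_1-d},\frac{y_{i+1}-c}{y_N-d},\frac{d-y_i}{c-y_1},\frac{d-y_{i+1}}{c-y_N}\Big\},$$ and $$v_{1i}=-u_i\Big[3+\frac{h_id_i-\alpha_i(x_N-x_1)d_1}{y_i-c-\alpha_i(y_1-c)}\Big],\qquad v_{2i}=-u_i\Big[3+\frac{-h_id_{i+1}+\alpha_i(x_N-x_1)d_N}{y_{i+1}-c-\alpha_i(y_N-c)}\Big],$$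 $$v_{3i}=-u_i\Big[3+\frac{-h_id_i+\alpha_i(x_N-x_1)d_1}{d-y_i-\alpha_i(d-y_1)}\Big],\qquad v_{4i}=-u_i\Big[3+\frac{h_id_{i+1}-\alpha_i(x_N-x_1)d_N}{d-y_{i+1}-\alpha_i(d-y_N)}\Big],$$ $$v_{5i}=-u_i\Big[3+\frac{h_id_i-\alpha_i(x_N-x_1)d_1}{y_i-c-\alpha_i(y_1-d)}\Big],\qquad v_{6i}=-u_i\Big[3+\frac{-h_id_{i+1}+\alpha_i(x_N-x_1)d_N}{y_{i+1}-c-\alpha_i(y_N-d)}\Big],$$ $$v_{7i}=-u_i\Big[3+\frac{-h_id_i+\alpha_i(x_N-x_1)d_1}{d-y_i-\alpha_i(c-y_1)}\Big],\qquad v_{8i}=-u_i\Big[3+\frac{h_id_{i+1}-\alpha_i(x_N-x_1)d_N}{d-y_{i+1}-\alpha_i(c-y_N)}\Big].$$ (Here $d$ without subscript is the upper bound of the rectangle, and $d_1,\dots,d_N$ are the derivative values.)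
   Context: Notation: $\mathbb{N}_r=\{1,2,\dots,r\}$; $N>2$; $x_1<x_2<\dots<x_N$ are real knots, $I=[x_1,x_N]$, $I_i=[x_i,x_{i+1}]$, $h_i=x_{i+1}-x_i$. The real numbers $y_i$ and $d_i$ are, respectively, the prescribed function value and derivative value at the knot $x_i$. For $i\in\mathbb{N}_{N-1}$, $L_i:I\to I_i$ is the affine map $L_i(x)=a_ix+b_i$ with $L_i(x_1)=x_i$, $L_i(x_N)=x_{i+1}$, so $a_i=\frac{x_{i+1}-x_i}{x_N-x_1}$ and $b_i=\frac{x_Nx_i-x_1x_{i+1}}{x_N-x_1}$. Rational cubic spline fractal interpolation function (RCSFIF): given scaling factors $\alpha_i$ with $|\alpha_i|<a_i$ and shape parameters $u_i>0$, $v_i\ge 0$ ($i\in\mathbb{N}_{N-1}$), the $\mathcal{C}^1$-RCSFIF $\Psi$ corresponding to the data $\{(x_i,y_i,d_i)\}$ is the unique continuous function $\Psi:I\to\mathbb{R}$ with $\Psi(x_1)=y_1$, $\Psi(x_N)=y_N$ satisfying, for all $x\in I$ and all $i\in\mathbb{N}_{N-1}$, $$\Psi(L_i(x))=\alpha_i\Psi(x)+\frac{P_i^*(\theta)}{Q_i^*(\theta)},\qquad \theta=\frac{x-x_1}{x_N-x_1},$$ where $Q_i^*(\theta)=u_i+v_i\theta(1-\theta)$ and $P_i^*(\theta)=U_i(1-\theta)^3+V_i(1-\theta)^2\theta+W_i(1-\theta)\theta^2+Z_i\theta^3$ with $$U_i=u_i(y_i-\alpha_iy_1),\qquad Z_i=u_i(y_{i+1}-\alpha_iy_N),$$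 $$V_i=(3u_i+v_i)(y_i-\alpha_iy_1)+u_ih_id_i-\alpha_iu_i(x_N-x_1)d_1,$$ $$W_i=(3u_i+v_i)(y_{i+1}-\alpha_iy_N)-u_ih_id_{i+1}+\alpha_iu_i(x_N-x_1)d_N.$$ *)

theory Defs
  imports "HOL-Analysis.Analysis"
begin

text \<open>
  Knots, function values, derivative values, scaling factors and shape parameters are functions
  on \<open>nat\<close>, of which only the indices \<open>1..N\<close> (for \<open>x\<close>, \<open>y\<close>, \<open>dv\<close>) and \<open>1..N-1\<close> (for
  \<open>\<alpha>\<close>, \<open>u\<close>, \<open>v\<close>) matter. The derivative value at the knot \<open>x i\<close> is written \<open>dv i\<close>, as
  \<open>d\<close> is kept for the upper bound of the rectangle.
\<close>

definition step :: "(nat \<Rightarrow> real) \<Rightarrow> nat \<Rightarrow> real" where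
  "step x i = x (i + 1) - x i"

definition a_coeff :: "nat \<Rightarrow> (nat \<Rightarrow> real) \<Rightarrow> nat \<Rightarrow> real" where
  "a_coeff N x i = (x (i + 1) - x i) / (x N - x 1)"

definition b_coeff :: "nat \<Rightarrow> (nat \<Rightarrow> real) \<Rightarrow> nat \<Rightarrow> real" where
  "b_coeff N x i = (x N * x i - x 1 * x (i + 1)) / (x N - x 1)"

definition L_map :: "nat \<Rightarrow> (nat \<Rightarrow> real) \<Rightarrow> nat \<Rightarrow> real \<Rightarrow> real" where
  "L_map N x i t = a_coeff N x i * t + b_coeff N x i"

definition U_coeff ::
  "(nat \<Rightarrow> real) \<Rightarrow> (nat \<Rightarrow> real) \<Rightarrow> (nat \<Rightarrow> real) \<Rightarrow> nat \<Rightarrow> real" where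
  "U_coeff y \<alpha> u i = u i * (y i - \<alpha> i * y 1)"

definition Z_coeff ::
  "nat \<Rightarrow> (nat \<Rightarrow> real) \<Rightarrow> (nat \<Rightarrow> real) \<Rightarrow> (nat \<Rightarrow> real) \<Rightarrow> nat \<Rightarrow> real" where
  "Z_coeff N y \<alpha> u i = u i * (y (i + 1) - \<alpha> i * y N)"

definition V_coeff ::
  "nat \<Rightarrow> (nat \<Rightarrow> real) \<Rightarrow> (nat \<Rightarrow> real) \<Rightarrow> (nat \<Rightarrow> real) \<Rightarrow> (nat \<Rightarrow> real) \<Rightarrow> (nat \<Rightarrow> real)
    \<Rightarrow> (nat \<Rightarrow> real) \<Rightarrow> nat \<Rightarrow> real" where
  "V_coeff N x y dv \<alpha> u v i =
     (3 * u i + v i) * (y i - \<alpha> i * y 1) + u i * step x i * dv i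
     - \<alpha> i * u i * (x N - x 1) * dv 1"

definition W_coeff ::
  "nat \<Rightarrow> (nat \<Rightarrow> real) \<Rightarrow> (nat \<Rightarrow> real) \<Rightarrow> (nat \<Rightarrow> real) \<Rightarrow> (nat \<Rightarrow> real) \<Rightarrow> (nat \<Rightarrow> real)
    \<Rightarrow> (nat \<Rightarrow> real) \<Rightarrow> nat \<Rightarrow> real" where
  "W_coeff N x y dv \<alpha> u v i =
     (3 * u i + v i) * (y (i + 1) - \<alpha> i * y N) - u i * step x i * dv (i + 1)
     + \<alpha> i * u i * (x N - x 1) * dv N"

definition P_star ::
  "nat \<Rightarrow> (nat \<Rightarrow> real) \<Rightarrow> (nat \<Rightarrow> real) \<Rightarrow> (nat \<Rightarrow> real) \<Rightarrow> (nat \<Rightarrow> real) \<Rightarrow> (nat \<Rightarrow> real)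
    \<Rightarrow> (nat \<Rightarrow> real) \<Rightarrow> nat \<Rightarrow> real \<Rightarrow> real" where
  "P_star N x y dv \<alpha> u v i \<theta> =
     U_coeff y \<alpha> u i * (1 - \<theta>) ^ 3
     + V_coeff N x y dv \<alpha> u v i * (1 - \<theta>) ^ 2 * \<theta>
     + W_coeff N x y dv \<alpha> u v i * (1 - \<theta>) * \<theta> ^ 2
     + Z_coeff N y \<alpha> u i * \<theta> ^ 3"

definition Q_star :: "(nat \<Rightarrow> real) \<Rightarrow> (nat \<Rightarrow> real) \<Rightarrow> nat \<Rightarrow> real \<Rightarrow> real" where
  "Q_star u v i \<theta> = u i + v i * \<theta> * (1 - \<theta>)"

text \<open>
  \<open>is_rcsfif N x y dv \<alpha> u v \<Psi>\<close>: the parameters are admissible and \<open>\<Psi>\<close> is the corresponding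
  rational cubic spline fractal interpolation function. These conditions determine \<open>\<Psi>\<close> on
  \<open>{x 1..x N}\<close>; its values outside this interval are irrelevant.
\<close>

definition is_rcsfif ::
  "nat \<Rightarrow> (nat \<Rightarrow> real) \<Rightarrow> (nat \<Rightarrow> real) \<Rightarrow> (nat \<Rightarrow> real) \<Rightarrow> (nat \<Rightarrow> real) \<Rightarrow> (nat \<Rightarrow> real)
    \<Rightarrow> (nat \<Rightarrow> real) \<Rightarrow> (real \<Rightarrow> real) \<Rightarrow> bool" where
  "is_rcsfif N x y dv \<alpha> u v \<Psi> \<longleftrightarrow>
     (\<forall>i\<in>{1..N - 1}. \<bar>\<alpha> i\<bar> < a_coeff N x i \<and> u i > 0 \<and> v i \<ge> 0) \<and>
     continuous_on {x 1..x N} \<Psi> \<and> \<Psi> (x 1) = y 1 \<and> \<Psi> (x N) = y N \<and>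
     (\<forall>i\<in>{1..N - 1}. \<forall>t\<in>{x 1..x N}.
        \<Psi> (L_map N x i t) =
          \<alpha> i * \<Psi> t
          + (let \<theta> = (t - x 1) / (x N - x 1)
             in P_star N x y dv \<alpha> u v i \<theta> / Q_star u v i \<theta>))"

text \<open>
  Lower bounds for the shape parameter \<open>v i\<close>; \<open>c\<close> and \<open>d\<close> are the lower and upper bounds of
  the rectangle.
\<close>

definition v1 where
  "v1 N x y dv \<alpha> u (c::real) (d::real) (i::nat) =
     - u i * (3 + (step x i * dv i - \<alpha> i * (x N - x 1) * dv 1)
                  / (y i - c - \<alpha> i * (y 1 - c)))"

definition v2 where
  "v2 N x y dv \<alpha> u (c::real) (d::real) (i::nat) =
     - u i * (3 + (- step x i * dv (i + 1) + \<alpha> i * (x N - x 1) * dv N)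
                  / (y (i + 1) - c - \<alpha> i * (y N - c)))"

definition v3 where
  "v3 N x y dv \<alpha> u (c::real) (d::real) (i::nat) =
     - u i * (3 + (- step x i * dv i + \<alpha> i * (x N - x 1) * dv 1)
                  / (d - y i - \<alpha> i * (d - y 1)))"

definition v4 where
  "v4 N x y dv \<alpha> u (c::real) (d::real) (i::nat) =
     - u i * (3 + (step x i * dv (i + 1) - \<alpha> i * (x N - x 1) * dv N)
                  / (d - y (i + 1) - \<alpha> i * (d - y N)))"

definition v5 where
  "v5 N x y dv \<alpha> u (c::real) (d::real) (i::nat) =
     - u i * (3 + (step x i * dv i - \<alpha> i * (x N - x 1) * dv 1)
                  / (y i - c - \<alpha> i * (y 1 - d)))"

definition v6 where
  "v6 N x y dv \<alpha> u (c::real) (d::real) (i::nat) =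
     - u i * (3 + (- step x i * dv (i + 1) + \<alpha> i * (x N - x 1) * dv N)
                  / (y (i + 1) - c - \<alpha> i * (y N - d)))"

definition v7 where
  "v7 N x y dv \<alpha> u (c::real) (d::real) (i::nat) =
     - u i * (3 + (- step x i * dv i + \<alpha> i * (x N - x 1) * dv 1)
                  / (d - y i - \<alpha> i * (c - y 1)))"

definition v8 where
  "v8 N x y dv \<alpha> u (c::real) (d::real) (i::nat) =
     - u i * (3 + (step x i * dv (i + 1) - \<alpha> i * (x N - x 1) * dv N)
                  / (d - y (i + 1) - \<alpha> i * (c - y N)))"

end

theory Submission
  imports Defs
begin

text \<open>
  Let \<open>E\<close> be the largest excess of \<open>\<Psi>\<close> beyond \<open>[c, d]\<close>; it is attained, by compactness. In the
  basis \<open>(1 - \<theta>)\<^sup>3, (1 - \<theta>)\<^sup>2 \<theta>, (1 - \<theta>) \<theta>\<^sup>2, \<theta>\<^sup>3\<close>, the conditions on the parameters say that the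
  coefficients of \<open>P - k Q\<close> have a fixed sign for each \<open>k\<close> among \<open>c - \<alpha> c\<close>, \<open>c - \<alpha> d\<close> (positive)
  and \<open>d - \<alpha> c\<close>, \<open>d - \<alpha> d\<close> (negative), so for \<open>\<theta> \<in> [0, 1]\<close> each map \<open>r \<mapsto> \<alpha> r + P \<theta> / Q \<theta>\<close> sends both \<open>c\<close> and \<open>d\<close>
  into \<open>[c, d]\<close>. The functional equation then multiplies the excess by at most \<open>\<bar>\<alpha>\<bar> < 1\<close>, whence
  \<open>E \<le> 0\<close>.
\<close>

lemma Q_star_pos:
  assumes "0 \<le> \<theta>" "\<theta> \<le> 1" "u i > 0" "v i \<ge> 0"
  shows "Q_star u v i \<theta> > 0"
  using assms unfolding Q_star_def by (simp add: add_pos_nonneg)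

text \<open>All four coefficients are linear in the data \<open>(y, dv)\<close>. Reflecting the data
  will turn upper bounds into lower bounds.\<close>

lemma P_star_uminus:
  "P_star N x (\<lambda>j. - y j) (\<lambda>j. - dv j) \<alpha> u v i \<theta> = - P_star N x y dv \<alpha> u v i \<theta>"
  unfolding P_star_def U_coeff_def V_coeff_def W_coeff_def Z_coeff_def
  by (simp add: algebra_simps)

lemma shape_bound_imp_pos:
  fixes A X u v :: real
  assumes "A > 0" "v > - u * (3 + X / A)"
  shows "(3 * u + v) * A + u * X > 0"
proof -
  have "(3 * u + v) * A + u * X = (v - (- u * (3 + X / A))) * A"
    using assms(1) by (simp add: field_simps)
  then show ?thesis
    using assms by simp
qed

text \<open>\<open>A\<close> and \<open>B\<close> are tied to \<open>k\<close> by equations so that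
  the denominators of \<open>v1\<close>, ..., \<open>v8\<close> can be inserted as they are written
  there.\<close>

lemma P_div_Q_lower:
  assumes \<theta>: "0 \<le> \<theta>" "\<theta> \<le> 1"
    and u: "u i > 0" and v: "v i \<ge> 0"
    and A: "A > 0" "A = y i - \<alpha> i * y 1 - k"
    and B: "B > 0" "B = y (i + 1) - \<alpha> i * y N - k"
    and vA: "v i > - u i * (3 + (step x i * dv i - \<alpha> i * (x N - x 1) * dv 1) / A)"
    and vB: "v i > - u i * (3 + (- step x i * dv (i + 1) + \<alpha> i * (x N - x 1) * dv N) / B)"
  shows "k \<le> P_star N x y dv \<alpha> u v i \<theta> / Q_star u v i \<theta>"
proof -
  define X where "X = step x i * dv i - \<alpha> i * (x N - x 1) * dv 1"
  define Y where "Y = - step x i * dv (i + 1) + \<alpha> i * (x N - x 1) * dv N"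
  define S where "S = (3 * u i + v i) * A + u i * X"
  define T where "T = (3 * u i + v i) * B + u i * Y"
  have "S > 0" "T > 0"
    using shape_bound_imp_pos[OF A(1) vA] shape_bound_imp_pos[OF B(1) vB]
    unfolding S_def T_def X_def Y_def .
  \<comment> \<open>Degree elevation: multiplying the quadratic \<open>Q_star\<close> by (1 -
    \<theta>) + \<theta> = 1 gives it the cubic coefficients u, 3u + v, 3u + v, u. These are the
    factors of the data in \<open>P_star\<close>, so subtracting \<open>k * Q_star\<close> just
    shifts those data by \<open>k\<close>.\<close>
  have Q: "Q_star u v i \<theta> = u i * (1 - \<theta>) ^ 3 + (3 * u i + v i) * (1 - \<theta>) ^ 2 * \<theta>
      + (3 * u i + v i) * (1 - \<theta>) * \<theta> ^ 2 + u i * \<theta> ^ 3"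
    by (simp add: Q_star_def power2_eq_square power3_eq_cube algebra_simps)
  have "P_star N x y dv \<alpha> u v i \<theta> - k * Q_star u v i \<theta> =
      u i * A * (1 - \<theta>) ^ 3 + S * (1 - \<theta>) ^ 2 * \<theta> + T * (1 - \<theta>) * \<theta> ^ 2
      + u i * B * \<theta> ^ 3"
    unfolding Q S_def T_def P_star_def U_coeff_def V_coeff_def W_coeff_def Z_coeff_def A(2) B(2) X_def Y_def
    by (simp add: algebra_simps)
  also have "\<dots> \<ge> 0"
    using \<theta> u A(1) B(1) \<open>S > 0\<close> \<open>T > 0\<close>
    by (intro add_nonneg_nonneg mult_nonneg_nonneg zero_le_power) simp_all
  finally show ?thesis
    using Q_star_pos[of \<theta> u i v, OF \<theta> u v] by (simp add: pos_le_divide_eq)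
qed

lemma P_div_Q_upper:
  assumes \<theta>: "0 \<le> \<theta>" "\<theta> \<le> 1"
    and u: "u i > 0" and v: "v i \<ge> 0"
    and A: "A > 0" "A = k - (y i - \<alpha> i * y 1)"
    and B: "B > 0" "B = k - (y (i + 1) - \<alpha> i * y N)"
    and vA: "v i > - u i * (3 + (- step x i * dv i + \<alpha> i * (x N - x 1) * dv 1) / A)"
    and vB: "v i > - u i * (3 + (step x i * dv (i + 1) - \<alpha> i * (x N - x 1) * dv N) / B)"
  shows "P_star N x y dv \<alpha> u v i \<theta> / Q_star u v i \<theta> \<le> k"
proof -
  \<comment> \<open>For the reflected data and \<open>- k\<close>, the quantities \<open>A\<close>
    and \<open>B\<close> stay the same.\<close>
  have "- k \<le> P_star N x (\<lambda>j. - y j) (\<lambda>j. - dv j) \<alpha> u v i \<theta> / Q_star u v i \<theta>"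
    by (rule P_div_Q_lower[where A = A and B = B]) (use assms in \<open>simp_all add: algebra_simps\<close>)
  then show ?thesis
    by (simp add: P_star_uminus)
qed

text \<open>An affine map is extremal at the ends \<open>c - E\<close> and \<open>d + E\<close>,
  whose images differ from those of \<open>c\<close> and \<open>d\<close> by \<bar>\<alpha>\<bar> *
  E; a negative slope swaps the ends. This also covers a negative \<open>E\<close>, as when the
  graph lies strictly inside the rectangle.\<close>

lemma affine_excess_le:
  fixes \<alpha> p c d r E :: real
  assumes "c \<le> \<alpha> * c + p" "c \<le> \<alpha> * d + p" "\<alpha> * c + p \<le> d" "\<alpha> * d + p \<le> d"
    and "c - E \<le> r" "r \<le> d + E"
  shows "c - \<bar>\<alpha>\<bar> * E \<le> \<alpha> * r + p \<and> \<alpha> * r + p \<le> d + \<bar>\<alpha>\<bar> * E"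
proof (cases "\<alpha> \<ge> 0")
  case True
  then have "\<alpha> * (c - E) \<le> \<alpha> * r" "\<alpha> * r \<le> \<alpha> * (d + E)"
    using assms(5,6) by (auto intro: mult_left_mono)
  with True assms(1-4) show ?thesis
    by (simp add: algebra_simps)
next
  case False
  then have "\<alpha> * (d + E) \<le> \<alpha> * r" "\<alpha> * r \<le> \<alpha> * (c - E)"
    using assms(5,6) by (auto intro: mult_left_mono_neg)
  with False assms(1-4) show ?thesis
    by (simp add: algebra_simps)
qed

lemma knot_interval:
  fixes x :: "nat \<Rightarrow> real"
  assumes "1 < n" "x 1 \<le> s" "s \<le> x n"
  shows "\<exists>i\<in>{1..n - 1}. x i \<le> s \<and> s \<le> x (i + 1)"
  using assms(1,3)
proof (induction n)
  case (Suc n)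
  show ?case
  proof (cases "1 < n \<and> s \<le> x n")
    case True
    then obtain i where "i \<in> {1..n - 1}" "x i \<le> s" "s \<le> x (i + 1)"
      using Suc.IH by blast
    then show ?thesis
      by (intro bexI[of _ i]) auto
  next
    case False
    \<comment> \<open>Either \<open>n = 1\<close>, or \<open>s\<close> lies beyond
      \<open>x n\<close>; in both cases the last interval contains \<open>s\<close>.\<close>
    then have "x n \<le> s"
      using Suc.prems assms(2) by (cases "n = 1") auto
    then show ?thesis
      using Suc.prems by (intro bexI[of _ n]) auto
  qed
qed simp

lemma L_map_covers:
  assumes "x 1 < x N" "x i < x (i + 1)" "x i \<le> s" "s \<le> x (i + 1)"
  shows "\<exists>t\<in>{x 1..x N}. L_map N x i t = s"
proof -
  \<comment> \<open>\<open>q\<close> is the relative position of \<open>s\<close> in its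
    subinterval; \<open>t\<close> takes the same relative position in the whole interval.\<close>
  define q where "q = (s - x i) / (x (i + 1) - x i)"
  have q: "0 \<le> q" "q \<le> 1" "q * (x (i + 1) - x i) = s - x i"
    using assms by (simp_all add: q_def field_simps)
  define t where "t = x 1 + q * (x N - x 1)"
  have "0 \<le> q * (x N - x 1)" "q * (x N - x 1) \<le> x N - x 1"
    using q assms(1) by (auto intro: mult_left_le_one_le)
  then have "t \<in> {x 1..x N}"
    unfolding t_def atLeastAtMost_iff by linarith
  moreover have "L_map N x i t = x i + q * (x (i + 1) - x i)"
    using assms(1) unfolding L_map_def a_coeff_def b_coeff_def t_def
    by (simp add: divide_simps) (simp add: algebra_simps)
  ultimately show ?thesis
    using q by auto
qed

theorem theorem2:
  fixes N :: nat
    and x y dv \<alpha> u v \<alpha>min \<alpha>max :: "nat \<Rightarrow> real"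
    and c d :: real
    and \<Psi> :: "real \<Rightarrow> real"
  assumes "N > 2"
    and "strict_mono_on {1..N} x"
    and "c < Min (y ` {1..N})"
    and "d > Max (y ` {1..N})"
    and "is_rcsfif N x y dv \<alpha> u v \<Psi>"
    and "\<And>i. i \<in> {1..N - 1} \<Longrightarrow>
           \<alpha>max i < Min {a_coeff N x i,
                         (y i - c) / (y 1 - c), (y (i + 1) - c) / (y N - c),
                         (d - y i) / (d - y 1), (d - y (i + 1)) / (d - y N)}"
    and "\<And>i. i \<in> {1..N - 1} \<Longrightarrow>
           \<alpha>min i > Max {- a_coeff N x i,
                         (y i - c) / (y 1 - d), (y (i + 1) - c) / (y N - d),
                         (d - y i) / (c - y 1), (d - y (i + 1)) / (c - y N)}"
    and "\<And>i. i \<in> {1..N - 1} \<Longrightarrow> \<alpha>min i < \<alpha> i \<and> \<alpha> i < \<alpha>max i"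
    and "\<And>i. i \<in> {1..N - 1} \<Longrightarrow> u i > 0"
    and "\<And>i. i \<in> {1..N - 1} \<Longrightarrow>
           v i > Max {0,
                      v1 N x y dv \<alpha> u c d i, v2 N x y dv \<alpha> u c d i,
                      v3 N x y dv \<alpha> u c d i, v4 N x y dv \<alpha> u c d i,
                      v5 N x y dv \<alpha> u c d i, v6 N x y dv \<alpha> u c d i,
                      v7 N x y dv \<alpha> u c d i, v8 N x y dv \<alpha> u c d i}"
  shows "{(t, \<Psi> t) | t. t \<in> {x 1..x N}} \<subseteq> {x 1..x N} \<times> {c..d}"
proof -
  define K where "K = {x 1..x N}"
  have y: "c < y j" "y j < d" if "j \<in> {1..N}" for j
    using assms(1,3,4) that by (auto simp: Min_gr_iff Max_less_iff)
  have mono: "x i < x j" if "i < j" "1 \<le> i" "j \<le> N" for i j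
    using strict_mono_onD[OF assms(2)] that by simp
  have le: "x i \<le> x j" if "i \<le> j" "1 \<le> i" "j \<le> N" for i j
    using mono[of i j] that by (cases "i = j") auto
  have x1N: "x 1 < x N"
    using mono assms(1) by simp
  have cont: "continuous_on K \<Psi>"
    using assms(5) by (simp add: is_rcsfif_def K_def)
  have \<alpha>_lt_1: "\<bar>\<alpha> i\<bar> < 1" if "i \<in> {1..N - 1}" for i
  proof -
    have "x (i + 1) - x i \<le> x N - x 1"
      using that assms(1) by (intro diff_mono le) auto
    then have "a_coeff N x i \<le> 1"
      using x1N by (simp add: a_coeff_def)
    then show ?thesis
      using assms(5) that by (force simp: is_rcsfif_def)
  qed
  have contract: "c - \<bar>\<alpha> i\<bar> * E \<le> \<Psi> (L_map N x i t) \<and> \<Psi> (L_map N x i t) \<le> d + \<bar>\<alpha> i\<bar> * E"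
    if i: "i \<in> {1..N - 1}" and t: "t \<in> K" and E: "c - E \<le> \<Psi> t" "\<Psi> t \<le> d + E" for i t E
  proof -
    define \<theta> where "\<theta> = (t - x 1) / (x N - x 1)"
    define p where "p = P_star N x y dv \<alpha> u v i \<theta> / Q_star u v i \<theta>"
    have \<theta>: "0 \<le> \<theta>" "\<theta> \<le> 1"
      using t x1N by (auto simp: \<theta>_def K_def)
    have ys: "c < y 1" "y 1 < d" "c < y N" "y N < d"
      using y assms(1) by auto
    note u = assms(9)[OF i]
    have v: "v i > 0" "v i > v1 N x y dv \<alpha> u c d i" "v i > v2 N x y dv \<alpha> u c d i"
      "v i > v3 N x y dv \<alpha> u c d i" "v i > v4 N x y dv \<alpha> u c d i"
      "v i > v5 N x y dv \<alpha> u c d i" "v i > v6 N x y dv \<alpha> u c d i"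
      "v i > v7 N x y dv \<alpha> u c d i" "v i > v8 N x y dv \<alpha> u c d i"
      by (rule le_less_trans[OF Max_ge assms(10)[OF i]]; simp)+
    have "\<alpha> i < (y i - c) / (y 1 - c)" "\<alpha> i < (y (i + 1) - c) / (y N - c)"
      "\<alpha> i < (d - y i) / (d - y 1)" "\<alpha> i < (d - y (i + 1)) / (d - y N)"
      by (rule less_trans[OF conjunct2[OF assms(8)[OF i]] less_le_trans[OF assms(6)[OF i] Min_le]]; simp)+
    moreover have "\<alpha> i > (y i - c) / (y 1 - d)" "\<alpha> i > (y (i + 1) - c) / (y N - d)"
      "\<alpha> i > (d - y i) / (c - y 1)" "\<alpha> i > (d - y (i + 1)) / (c - y N)"
      by (rule less_trans[OF le_less_trans[OF Max_ge assms(7)[OF i]] conjunct1[OF assms(8)[OF i]]]; simp)+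
    \<comment> \<open>The upper bounds on \<open>\<alpha> i\<close> give the first four. The lower
      bounds give the last four, where the cleared denominators are negative.\<close>
    ultimately have pos: "y i - c - \<alpha> i * (y 1 - c) > 0" "y (i + 1) - c - \<alpha> i * (y N - c) > 0"
      "d - y i - \<alpha> i * (d - y 1) > 0" "d - y (i + 1) - \<alpha> i * (d - y N) > 0"
      "y i - c - \<alpha> i * (y 1 - d) > 0" "y (i + 1) - c - \<alpha> i * (y N - d) > 0"
      "d - y i - \<alpha> i * (c - y 1) > 0" "d - y (i + 1) - \<alpha> i * (c - y N) > 0"
      using ys by (simp_all add: pos_less_divide_eq neg_divide_less_eq)
    note bounds = P_div_Q_lower P_div_Q_upper
    note bounds = bounds[where N = N and x = x and y = y and dv = dv and \<alpha> = \<alpha>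
        and u = u and v = v and i = i, OF \<theta> u less_imp_le[OF v(1)]]
    \<comment> \<open>Each of the next four bounds puts the image of \<open>c\<close> or
      \<open>d\<close> on the right side of one edge of the rectangle, and uses one pair of the
      \<open>v\<close> bounds.\<close>
    have "c - \<alpha> i * c \<le> p"
      unfolding p_def
      by (rule bounds(1)[OF pos(1) _ pos(2) _ v(2,3)[unfolded v1_def v2_def]])
        (simp_all add: algebra_simps)
    moreover have "c - \<alpha> i * d \<le> p"
      unfolding p_def
      by (rule bounds(1)[OF pos(5) _ pos(6) _ v(6,7)[unfolded v5_def v6_def]])
        (simp_all add: algebra_simps)
    moreover have "p \<le> d - \<alpha> i * d"
      unfolding p_def
      by (rule bounds(2)[OF pos(3) _ pos(4) _ v(4,5)[unfolded v3_def v4_def]])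
        (simp_all add: algebra_simps)
    moreover have "p \<le> d - \<alpha> i * c"
      unfolding p_def
      by (rule bounds(2)[OF pos(7) _ pos(8) _ v(8,9)[unfolded v7_def v8_def]])
        (simp_all add: algebra_simps)
    moreover have "\<Psi> (L_map N x i t) = \<alpha> i * \<Psi> t + p"
      using assms(5) i t by (simp add: is_rcsfif_def p_def \<theta>_def K_def Let_def)
    ultimately show ?thesis
      using affine_excess_le[of c "\<alpha> i" p d E "\<Psi> t"] E by simp
  qed
  \<comment> \<open>\<open>g\<close> is the signed excess: \<open>g t \<le> E\<close> means exactly
    that \<open>\<Psi> t\<close> lies between \<open>c - E\<close> and \<open>d + E\<close>.\<close>
  define g where "g t = max (c - \<Psi> t) (\<Psi> t - d)" for t
  have "continuous_on K g"
    unfolding g_def by (intro continuous_intros cont)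
  then obtain s where s: "s \<in> K" "\<And>t. t \<in> K \<Longrightarrow> g t \<le> g s"
    using continuous_attains_sup[of K g] x1N by (auto simp: K_def)
  obtain i where i: "i \<in> {1..N - 1}" "x i \<le> s" "s \<le> x (i + 1)"
    using knot_interval[of N x s] s(1) assms(1) by (auto simp: K_def)
  obtain t where t: "t \<in> K" "L_map N x i t = s"
    using L_map_covers[of x N i s] mono[of i "i + 1"] i x1N by (auto simp: K_def)
  have "c - g s \<le> \<Psi> t" "\<Psi> t \<le> d + g s"
    using s(2)[OF t(1)] by (auto simp: g_def)
  then have "c - \<bar>\<alpha> i\<bar> * g s \<le> \<Psi> s \<and> \<Psi> s \<le> d + \<bar>\<alpha> i\<bar> * g s"
    using contract[OF i(1) t(1), of "g s"] t(2) by simp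
  \<comment> \<open>At \<open>s\<close> one of the two sides is attained with equality, so the
    contracted bound applies to \<open>g s\<close> itself.\<close>
  moreover have "g s = c - \<Psi> s \<or> g s = \<Psi> s - d"
    by (auto simp: g_def)
  ultimately have "g s \<le> \<bar>\<alpha> i\<bar> * g s"
    by linarith
  then have "(1 - \<bar>\<alpha> i\<bar>) * g s \<le> 0"
    by (simp add: algebra_simps)
  then have "g s \<le> 0"
    using \<alpha>_lt_1[OF i(1)] by (simp add: mult_le_0_iff)
  then have "c \<le> \<Psi> t \<and> \<Psi> t \<le> d" if "t \<in> K" for t
    using s(2)[OF that] by (auto simp: g_def)
  then show ?thesis
    by (auto simp: K_def)
qed

end
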